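(* Let $S$ be a $*$-monoid and let $a,w\in S$. Then $a$ is $w$-core invertible if and only if $a^*$ is dual $w^*$-core invertible. In this case, if $a_w^{\#}$ denotes the $w$-core inverse of $a$ and $(a^* )_{w^*,\#}$ denotes the dual $w^*$-core inverse of $a^*$, then $(a_w^{\#})^*=(a^* )_{w^*,\#}$.
   Context: A $*$-monoid is a semigroup $S$ with identity $1$ and a map $*$ satisfying $(x^* )^*=x$ and $(xy)^*=y^*x^*$ for all $x,y\in S$. For $a,w\in S$, $a$ is $w$-core invertible if there exists $x\in S$ with $awx^2=x$, $xawa=a$ and $(awx)^*=awx$. Such an $x$ is unique if it exists and is called the $w$-core inverse of $a$. For $b,v\in S$, $b$ is dual $v$-core invertible if there exists $y\in S$ with $bvby=b$, $y^2vb=y$ and $(yvb)^*=yvb$. Such a $y$ is unique if it exists and is called the dual $v$-core inverse of $b$. *)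

theory Defs
  imports Main
begin

class star_monoid = monoid_mult +
  fixes star :: "'a \<Rightarrow> 'a"  ("_\<^sup>\<star>" [1000] 999)
  assumes star_star: "(x\<^sup>\<star>)\<^sup>\<star> = x"
    and star_mult: "(x * y)\<^sup>\<star> = y\<^sup>\<star> * x\<^sup>\<star>"

context star_monoid
begin

text \<open>In each definition below the weight is the first argument.\<close>

definition is_core_inverse :: "'a \<Rightarrow> 'a \<Rightarrow> 'a \<Rightarrow> bool" where
  "is_core_inverse w a x \<longleftrightarrow>
     a * w * x^2 = x \<and> x * a * w * a = a \<and> (a * w * x)\<^sup>\<star> = a * w * x"

definition core_invertible :: "'a \<Rightarrow> 'a \<Rightarrow> bool" where
  "core_invertible w a \<longleftrightarrow> (\<exists>x. is_core_inverse w a x)"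

definition is_dual_core_inverse :: "'a \<Rightarrow> 'a \<Rightarrow> 'a \<Rightarrow> bool" where
  "is_dual_core_inverse v b y \<longleftrightarrow>
     b * v * b * y = b \<and> y^2 * v * b = y \<and> (y * v * b)\<^sup>\<star> = y * v * b"

definition dual_core_invertible :: "'a \<Rightarrow> 'a \<Rightarrow> bool" where
  "dual_core_invertible v b \<longleftrightarrow> (\<exists>y. is_dual_core_inverse v b y)"

text \<open>
  The uniqueness lemmas \<open>is_core_inverse_unique\<close> and \<open>is_dual_core_inverse_unique\<close>
  show that the following descriptions denote whenever an inverse exists; otherwise
  their values are unspecified.
\<close>

definition core_inverse :: "'a \<Rightarrow> 'a \<Rightarrow> 'a" where
  "core_inverse w a = (THE x. is_core_inverse w a x)"

definition dual_core_inverse :: "'a \<Rightarrow> 'a \<Rightarrow> 'a" where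
  "dual_core_inverse v b = (THE y. is_dual_core_inverse v b y)"

lemma is_core_inverse_absorb:
  assumes "is_core_inverse w a x"
  shows "a * w * x * a = a" and "x * a * w * x = x"
proof -
  have 1: "a * w * x * x = x" and 2: "x * a * w * a = a"
    using assms by (simp_all add: is_core_inverse_def power2_eq_square mult_assoc)
  have "a * w * x * a = a * w * x * (x * a * w * a)" by (simp only: 2)
  also have "\<dots> = (a * w * x * x) * a * w * a" by (simp only: mult_assoc)
  finally show "a * w * x * a = a" by (simp only: 1 2)
  have "x * a * w * x = x * a * w * (a * w * x * x)" by (simp only: 1)
  also have "\<dots> = (x * a * w * a) * w * x * x" by (simp only: mult_assoc)
  finally show "x * a * w * x = x" by (simp only: 1 2)
qed

lemma is_core_inverse_unique:
  assumes x: "is_core_inverse w a x" and y: "is_core_inverse w a y"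
  shows "x = y"
proof -
  have x1: "x * a * w * a = a" and xs: "(a * w * x)\<^sup>\<star> = a * w * x"
    using x by (simp_all add: is_core_inverse_def)
  have y1: "a * w * y * y = y" and ys: "(a * w * y)\<^sup>\<star> = a * w * y"
    using y by (simp_all add: is_core_inverse_def power2_eq_square mult_assoc)
  have xy: "(a * w * x) * (a * w * y) = a * w * y"
    using is_core_inverse_absorb(1)[OF x] by (metis mult_assoc)
  have yx: "(a * w * y) * (a * w * x) = a * w * x"
    using is_core_inverse_absorb(1)[OF y] by (metis mult_assoc)
  have eq: "a * w * x = a * w * y"
    using xy yx xs ys star_mult by metis
  have "x = x * (a * w * x)"
    using is_core_inverse_absorb(2)[OF x] by (simp only: mult_assoc)
  also have "\<dots> = x * (a * w * y)" by (simp only: eq)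
  also have "\<dots> = x * a * w * y" by (simp only: mult_assoc)
  also have "\<dots> = x * a * w * (a * w * y * y)" by (simp only: y1)
  also have "\<dots> = (x * a * w * a) * w * y * y" by (simp only: mult_assoc)
  finally show ?thesis by (simp only: x1 y1)
qed

lemma is_dual_core_inverse_absorb:
  assumes "is_dual_core_inverse v b y"
  shows "b * y * v * b = b" and "y * v * b * y = y"
proof -
  have 1: "y * y * v * b = y" and 2: "b * v * b * y = b"
    using assms by (simp_all add: is_dual_core_inverse_def power2_eq_square)
  have "b * y * v * b = (b * v * b * y) * y * v * b" by (simp only: 2)
  also have "\<dots> = b * v * b * (y * y * v * b)" by (simp only: mult_assoc)
  finally show "b * y * v * b = b" by (simp only: 1 2)
  have "y * v * b * y = (y * y * v * b) * v * b * y" by (simp only: 1)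
  also have "\<dots> = y * y * v * (b * v * b * y)" by (simp only: mult_assoc)
  finally show "y * v * b * y = y" by (simp only: 1 2)
qed

lemma is_dual_core_inverse_unique:
  assumes x: "is_dual_core_inverse v b x" and y: "is_dual_core_inverse v b y"
  shows "x = y"
proof -
  have x1: "b * v * b * x = b" and xs: "(x * v * b)\<^sup>\<star> = x * v * b"
    using x by (simp_all add: is_dual_core_inverse_def)
  have y1: "y * y * v * b = y" and ys: "(y * v * b)\<^sup>\<star> = y * v * b"
    using y by (simp_all add: is_dual_core_inverse_def power2_eq_square)
  have xy: "(x * v * b) * (y * v * b) = x * v * b"
    using is_dual_core_inverse_absorb(1)[OF y] by (metis mult_assoc)
  have yx: "(y * v * b) * (x * v * b) = y * v * b"
    using is_dual_core_inverse_absorb(1)[OF x] by (metis mult_assoc)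
  have eq: "x * v * b = y * v * b"
    using xy yx xs ys star_mult by metis
  have "x = x * v * b * x"
    by (simp only: is_dual_core_inverse_absorb(2)[OF x])
  also have "\<dots> = (y * y * v * b) * v * b * x" by (simp only: eq y1)
  also have "\<dots> = y * y * v * (b * v * b * x)" by (simp only: mult_assoc)
  finally show ?thesis by (simp only: x1 y1)
qed

end

end

theory Submission
  imports Defs
begin

text \<open>The involution reverses products and is a bijection. Applying it to the three equations
  that make \<open>x\<close> a core inverse of \<open>a\<close> with weight \<open>w\<close> yields
  exactly the three dual equations for the starred elements, and injectivity makes this an
  equivalence (\<open>is_dual_core_inverse_star_iff\<close>). Surjectivity then transfers existence,
  and uniqueness on both sides identifies the inverses themselves.\<close>

context star_monoid
begin

lemma star_eq_iff: "x\<^sup>\<star> = y\<^sup>\<star> \<longleftrightarrow> x = y"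
  by (metis star_star)

lemma is_dual_core_inverse_star_iff:
  "is_dual_core_inverse (w\<^sup>\<star>) (a\<^sup>\<star>) (x\<^sup>\<star>) \<longleftrightarrow> is_core_inverse w a x"
proof -
  have "a\<^sup>\<star> * w\<^sup>\<star> * a\<^sup>\<star> * x\<^sup>\<star> = (x * a * w * a)\<^sup>\<star>"
    and "(x\<^sup>\<star>)^2 * w\<^sup>\<star> * a\<^sup>\<star> = (a * w * x^2)\<^sup>\<star>"
    and "x\<^sup>\<star> * w\<^sup>\<star> * a\<^sup>\<star> = (a * w * x)\<^sup>\<star>"
    by (simp_all add: star_mult power2_eq_square mult_assoc)
  \<comment> \<open>Each dual equation is now an equation between two stars, and one star cancels.
    For the symmetry condition this leaves
    \<open>(a * w * x)\<^sup>\<star> = a * w * x\<close>.\<close>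
  then show ?thesis
    unfolding is_dual_core_inverse_def is_core_inverse_def
    by (auto simp: star_eq_iff)
qed

text \<open>Every candidate \<open>y\<close> for the dual inverse is itself a star, namely of
  \<open>y\<^sup>\<star>\<close>, so no witness is missed.\<close>

lemma dual_core_invertible_star_iff:
  "dual_core_invertible (w\<^sup>\<star>) (a\<^sup>\<star>) \<longleftrightarrow> core_invertible w a"
  unfolding dual_core_invertible_def core_invertible_def
  by (metis is_dual_core_inverse_star_iff star_star)

text \<open>Uniqueness lets the definite description be evaluated at any known witness.\<close>

lemma core_inverse_eq: "is_core_inverse w a x \<Longrightarrow> core_inverse w a = x"
  unfolding core_inverse_def by (blast intro: is_core_inverse_unique)

lemma dual_core_inverse_eq: "is_dual_core_inverse v b y \<Longrightarrow> dual_core_inverse v b = y"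
  unfolding dual_core_inverse_def by (blast intro: is_dual_core_inverse_unique)

text \<open>A witness \<open>x\<close> evaluates the left description, and its star evaluates the
  right one.\<close>

lemma star_core_inverse:
  assumes "core_invertible w a"
  shows "(core_inverse w a)\<^sup>\<star> = dual_core_inverse (w\<^sup>\<star>) (a\<^sup>\<star>)"
  using assms unfolding core_invertible_def
  by (metis core_inverse_eq dual_core_inverse_eq is_dual_core_inverse_star_iff)

end

theorem proposition2p20:
  fixes a w :: "'a :: star_monoid"
  shows "(core_invertible w a \<longleftrightarrow> dual_core_invertible (w\<^sup>\<star>) (a\<^sup>\<star>)) \<and>
    (core_invertible w a \<longrightarrow>
       (core_inverse w a)\<^sup>\<star> = dual_core_inverse (w\<^sup>\<star>) (a\<^sup>\<star>))"
  by (simp add: dual_core_invertible_star_iff star_core_inverse)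

end
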